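(* Let $r_J>0$ and consider the linear system $$\frac{d\mathbb{W}}{dr}=\mathbb{A}(r)\mathbb{W},\qquad \mathbb{A}(r)=\begin{bmatrix} \dfrac1r+\dfrac{4\mu+6\mathcal{E}}{3r\phi^2} & \dfrac{6\mathcal{E}}{r^2\phi^2} \\ 1 & 0 \end{bmatrix},\qquad \mathbb{W}=\begin{bmatrix} s \\ u \end{bmatrix},$$ equivalent to the Tolman--Oppenheimer--Volkoff (TOV) equations, with $\mathbb{A}$ analytic at $r_J$ with power series $\mathbb{A}(r)=\sum_{m\ge0}\mathbb{A}_m(r-r_J)^m$. Then the general analytic solution around $r=r_J$ is $$\mathbb{W}=\mathbb{C}(r)\begin{bmatrix} c_1 \\ c_2 \end{bmatrix},\qquad \mathbb{C}(r)=\sum_{m=0}^{+\infty}\mathbb{C}_m(r-r_J)^m,$$ where $c_1,c_2$ are integration constants and $$\mathbb{C}_0=\mathbb{I}_2,\qquad \mathbb{C}_m=\frac1m\sum_{k=0}^{m-1}\mathbb{A}_{m-1-k}\mathbb{C}_k\quad(m\ge1).$$ Moreover, setting $c_2=1$, the constant $c_1$ is given in terms of the pressure $p_J=p(r_J)$ and the mass $M_J=M(r_J)=\frac12\int_0^{r_J}\mu(x)x^2\,dx$ by $$c_1=\frac{r_J}{2\left(1-\frac{2M_J}{r_J}\right)}\left(p_J+\frac{2M_J}{r_J^3}\right).$$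
   Context: Units $8\pi G=c=1$, cosmological constant $\Lambda=0$. The TOV equations for the energy density $\mu(r)$ and pressure $p(r)$ are $$\frac{dp}{dr}=-\frac{r^{2}(\mu+p)}{2(r-2M)}\left(p+\frac{2M}{r^{3}}\right),\qquad M(r)=\frac12\int_0^r\mu(x)x^2\,dx ,$$ with $r>2M(r)$. Define $$\phi=\frac{2}{r}\sqrt{1-\frac{2M}{r}},\qquad \mathcal{A}\phi=p+\frac{2M}{r^{3}},\qquad \mathcal{E}=\frac13\mu-\frac{2M}{r^{3}},$$ and let $u$ be such that $\frac{2\mathcal{A}}{r\phi}=\frac1u\frac{du}{dr}$, and $s=\frac{du}{dr}$; thus $\mathcal{A}=\frac{r\phi s}{2u}$ and $p=\mathcal{E}+\mathcal{A}\phi-\frac13\mu$. $\mathbb{I}_2$ is the $2\times2$ identity matrix. *)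

theory Defs
  imports "HOL-Analysis.Analysis"
begin

text \<open>
  Units are \<open>8 \<pi> G = c = 1\<close>, and the cosmological constant is 0. The energy density \<open>\<mu>\<close> and the
  pressure \<open>p\<close> are functions of the radius. The integral is the Henstock-Kurzweil integral, so
  integrability of the integrand has to be assumed where \<open>mass\<close> is used.
\<close>

definition mass :: "(real \<Rightarrow> real) \<Rightarrow> real \<Rightarrow> real" where
  "mass \<mu> r = 1/2 * integral {0..r} (\<lambda>x. \<mu> x * x^2)"

definition TOV :: "(real \<Rightarrow> real) \<Rightarrow> (real \<Rightarrow> real) \<Rightarrow> real \<Rightarrow> bool" where
  "TOV \<mu> p r \<longleftrightarrow>
     (p has_real_derivative
        - (r^2 * (\<mu> r + p r) / (2 * (r - 2 * mass \<mu> r))) * (p r + 2 * mass \<mu> r / r^3)) (at r)"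

definition phi :: "(real \<Rightarrow> real) \<Rightarrow> real \<Rightarrow> real" where
  "phi \<mu> r = 2 / r * sqrt (1 - 2 * mass \<mu> r / r)"

text \<open>The paper's \<open>\<A>\<close> is determined by \<open>\<A> \<phi> = p + 2 M / r\<^sup>3\<close>, since \<open>\<phi> > 0\<close> where
  \<open>r > 0\<close> and \<open>r > 2 M\<close>.\<close>

definition calA :: "(real \<Rightarrow> real) \<Rightarrow> (real \<Rightarrow> real) \<Rightarrow> real \<Rightarrow> real" where
  "calA \<mu> p r = (p r + 2 * mass \<mu> r / r^3) / phi \<mu> r"

definition calE :: "(real \<Rightarrow> real) \<Rightarrow> real \<Rightarrow> real" where
  "calE \<mu> r = 1/3 * \<mu> r - 2 * mass \<mu> r / r^3"

text \<open>\<open>u\<close> and \<open>s = du/dr\<close> are the new variables that belong to the pressure \<open>p\<close>.\<close>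

definition new_variables ::
    "(real \<Rightarrow> real) \<Rightarrow> (real \<Rightarrow> real) \<Rightarrow> (real \<Rightarrow> real) \<Rightarrow> (real \<Rightarrow> real) \<Rightarrow> real \<Rightarrow> bool" where
  "new_variables \<mu> p s u r \<longleftrightarrow>
     u r \<noteq> 0 \<and> (u has_real_derivative s r) (at r) \<and>
     2 * calA \<mu> p r / (r * phi \<mu> r) = 1 / u r * s r"

definition sys_matrix :: "(real \<Rightarrow> real) \<Rightarrow> real \<Rightarrow> real^2^2" where
  "sys_matrix \<mu> r =
     vector [vector [1 / r + (4 * \<mu> r + 6 * calE \<mu> r) / (3 * r * (phi \<mu> r)^2),
                     6 * calE \<mu> r / (r^2 * (phi \<mu> r)^2)],
             vector [1, 0]]"

definition solves_system :: "(real \<Rightarrow> real^2^2) \<Rightarrow> (real \<Rightarrow> real^2) \<Rightarrow> real \<Rightarrow> bool" where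
  "solves_system A W r \<longleftrightarrow> (W has_vector_derivative A r *v W r) (at r)"

text \<open>Real-analyticity at a point; the library's \<open>analytic_on\<close> is for complex functions only.\<close>

definition has_power_series_at ::
    "(real \<Rightarrow> 'a::real_normed_vector) \<Rightarrow> (nat \<Rightarrow> 'a) \<Rightarrow> real \<Rightarrow> bool" where
  "has_power_series_at f a x \<longleftrightarrow>
     (\<exists>\<delta>>0. \<forall>r\<in>ball x \<delta>. (\<lambda>m. (r - x)^m *\<^sub>R a m) sums f r)"

definition real_analytic_at :: "(real \<Rightarrow> 'a::real_normed_vector) \<Rightarrow> real \<Rightarrow> bool" where
  "real_analytic_at f x \<longleftrightarrow> (\<exists>a. has_power_series_at f a x)"

fun C_coeff :: "(nat \<Rightarrow> real^2^2) \<Rightarrow> nat \<Rightarrow> real^2^2" where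
  "C_coeff Am m =
     (if m = 0 then mat 1
      else (1 / real m) *\<^sub>R (\<Sum>k\<in>{0..m-1}. Am (m - 1 - k) ** C_coeff Am k))"

declare C_coeff.simps [simp del]

definition C_matrix :: "(nat \<Rightarrow> real^2^2) \<Rightarrow> real \<Rightarrow> real \<Rightarrow> real^2^2" where
  "C_matrix Am x r = (\<Sum>m. (r - x)^m *\<^sub>R C_coeff Am m)"

end

theory Submission
  imports Defs
begin

text \<open>
  Write \<open>h = 1 - 2 M / r\<close> and \<open>Q = r (p + 2 M / r\<^sup>3) / (2 h)\<close>, so that the change of variables is
  \<open>s = Q u\<close>, \<open>s = u'\<close>. Since \<open>M' = \<mu> r\<^sup>2 / 2\<close>, the TOV equation for \<open>p\<close> is pointwise equivalent to
  the Riccati equation \<open>Q' = a Q + b - Q\<^sup>2\<close>, where \<open>(a, b)\<close> is the first row of the matrix, and this is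
  the linear system for \<open>(s, u)\<close>. (That \<open>\<mu>\<close> is continuous, so that \<open>M\<close> is differentiable, follows from the
  continuity of \<open>b\<close>.) The recursion for \<open>C\<^sub>m\<close> gives a geometric bound on \<open>C\<^sub>m\<close>, hence convergence; the
  Cauchy product gives \<open>C' = A C\<close>, and Gronwall's inequality gives uniqueness. Evaluating \<open>s = Q u\<close> at
  \<open>r\<^sub>J\<close> forces \<open>c\<^sub>1 = Q(r\<^sub>J)\<close>; conversely, with this \<open>c\<^sub>1\<close>, uniqueness for scalar linear equations shows
  that \<open>s = Q u\<close> and \<open>u \<noteq> 0\<close> everywhere.
\<close>

section \<open>Bilinear matrix products and componentwise derivatives\<close>

lemma bounded_bilinear_matrix_vector_mult:
  "bounded_bilinear (\<lambda>(A::real^'n^'m) x. A *v x)"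
  unfolding bilinear_conv_bounded_bilinear[symmetric] bilinear_def
  by (auto intro!: linearI simp: matrix_vector_right_distrib matrix_vector_mult_add_rdistrib
      matrix_vector_mult_scaleR scaleR_matrix_vector_assoc)

lemma bounded_bilinear_matrix_matrix_mult:
  "bounded_bilinear (\<lambda>(A::real^'n^'m) (B::real^'k^'n). A ** B)"
  unfolding bilinear_conv_bounded_bilinear[symmetric] bilinear_def
  by (auto intro!: linearI simp: matrix_add_ldistrib
      matrix_matrix_mult_def vec_eq_iff sum.distrib distrib_left distrib_right sum_distrib_left mult_ac)

text \<open>Passing to components makes the scalar rules for power series and products available for
  vectors. For the converse, the normalised remainder tends to zero in each of finitely many
  coordinates.\<close>

lemma has_vector_derivative_vec:
  fixes f :: "real \<Rightarrow> real^'n"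
  shows "(f has_vector_derivative f') (at x) \<longleftrightarrow>
    (\<forall>i. ((\<lambda>x. f x $ i) has_real_derivative f' $ i) (at x))"
proof
  assume "(f has_vector_derivative f') (at x)"
  then show "\<forall>i. ((\<lambda>x. f x $ i) has_real_derivative f' $ i) (at x)"
    by (auto simp: has_real_derivative_iff_has_vector_derivative
        intro: bounded_linear.has_vector_derivative[OF bounded_linear_vec_nth])
next
  assume *: "\<forall>i. ((\<lambda>x. f x $ i) has_real_derivative f' $ i) (at x)"
  show "(f has_vector_derivative f') (at x)"
    unfolding has_vector_derivative_def has_derivative_within
  proof (intro conjI vec_tendstoI)
    show "bounded_linear (\<lambda>h. h *\<^sub>R f')"
      by (rule bounded_linear_scaleR_left)
    fix i
    show "((\<lambda>y. ((1 / norm (y - x)) *\<^sub>R (f y - (f x + (y - x) *\<^sub>R f'))) $ i) \<longlongrightarrow> 0 $ i) (at x)"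
      using *[rule_format, of i]
      unfolding has_real_derivative_iff_has_vector_derivative has_vector_derivative_def
        has_derivative_within by simp
  qed
qed

section \<open>Gronwall estimate and uniqueness for linear systems\<close>

text \<open>Gronwall: the derivative of \<open>\<parallel>V\<parallel>\<^sup>2\<close> is at most \<open>2 g \<parallel>V\<parallel>\<^sup>2\<close> in absolute value, and \<open>g\<close> is bounded
  on the compact segment between \<open>a\<close> and \<open>t\<close>.\<close>

lemma zero_of_norm_derivative_le:
  fixes V V' :: "real \<Rightarrow> 'a::real_inner"
  assumes S: "is_interval S" "a \<in> S" "t \<in> S"
    and g: "continuous_on S g"
    and V: "\<And>r. r \<in> S \<Longrightarrow> (V has_vector_derivative V' r) (at r)"
    and le: "\<And>r. r \<in> S \<Longrightarrow> norm (V' r) \<le> g r * norm (V r)"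
    and a: "V a = 0"
  shows "V t = 0"
proof -
  define I where "I = {min a t..max a t}"
  have I: "I \<subseteq> S"
    unfolding I_def using S
    by (cases "a \<le> t") (auto simp: min_absorb1 min_absorb2 max_absorb1 max_absorb2
        dest: mem_is_interval_1_I[OF S(1,2,3)] mem_is_interval_1_I[OF S(1,3,2)])
  have "compact (g ` I)"
    using g I by (intro compact_continuous_image continuous_on_subset[OF g]) (auto simp: I_def)
  then have "bounded (g ` I)" by (rule compact_imp_bounded)
  then obtain L where L: "\<And>x. x \<in> I \<Longrightarrow> norm (g x) \<le> L"
    unfolding bounded_iff by auto
  define f where "f = (\<lambda>x. V x \<bullet> V x)"
  have f: "(f has_real_derivative 2 * (V x \<bullet> V' x)) (at x)" if "x \<in> I" for x
  proof -
    have V_x: "(V has_derivative (\<lambda>h. h *\<^sub>R V' x)) (at x)"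
      using V[of x] that I by (auto simp: has_vector_derivative_def)
    show ?thesis
      unfolding f_def has_field_derivative_def
      by (rule has_derivative_eq_rhs[OF has_derivative_inner[OF V_x V_x]])
        (auto simp: inner_commute algebra_simps)
  qed
  have f_le: "\<bar>2 * (V x \<bullet> V' x)\<bar> \<le> 2 * L * f x" if "x \<in> I" for x
  proof -
    have "\<bar>V x \<bullet> V' x\<bar> \<le> norm (V x) * norm (V' x)"
      by (rule Cauchy_Schwarz_ineq2)
    also have "\<dots> \<le> norm (V x) * (L * norm (V x))"
    proof (rule mult_left_mono)
      have "norm (V' x) \<le> g x * norm (V x)" using le that I by auto
      also have "\<dots> \<le> L * norm (V x)"
        using L[OF that] by (intro mult_right_mono) auto
      finally show "norm (V' x) \<le> L * norm (V x)" .
    qed simp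
    also have "\<dots> = L * f x"
      by (simp add: f_def power2_norm_eq_inner[symmetric] power2_eq_square)
    finally show ?thesis by simp
  qed
  have f0: "f a = 0" and f_ge: "f t \<ge> 0" by (auto simp: f_def a)
  have "f t \<le> 0"
  proof (cases "a \<le> t")
    case True
    \<comment> \<open>To the right of \<open>a\<close>, the bound \<open>f' \<le> 2 L f\<close>
      makes \<open>f x * exp (- 2 * L * x)\<close> nonincreasing, and it vanishes at
      \<open>a\<close>.\<close>
    have "f a * exp (- 2 * L * a) \<ge> f t * exp (- 2 * L * t)"
    proof (rule DERIV_nonpos_imp_nonincreasing[OF True])
      fix x assume "a \<le> x" "x \<le> t"
      then have x: "x \<in> I" by (auto simp: I_def)
      have "((\<lambda>x. f x * exp (- 2 * L * x)) has_real_derivative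
          (2 * (V x \<bullet> V' x) - 2 * L * f x) * exp (- 2 * L * x)) (at x)"
        by (auto intro!: derivative_eq_intros f x simp: algebra_simps)
      then show "\<exists>y. ((\<lambda>x. f x * exp (- 2 * L * x)) has_real_derivative y) (at x) \<and> y \<le> 0"
        using f_le[OF x] by (intro exI conjI) (auto simp: mult_le_0_iff)
    qed
    then show ?thesis using f0 by (simp add: mult_le_0_iff not_le)
  next
    case False
    then have ta: "t \<le> a" by simp
    \<comment> \<open>To the left of \<open>a\<close>, the lower bound
      \<open>f' \<ge> - 2 L f\<close> is used instead, so the integrating factor changes
      sign.\<close>
    have "f t * exp (2 * L * t) \<le> f a * exp (2 * L * a)"
    proof (rule DERIV_nonneg_imp_nondecreasing[OF ta])
      fix x assume "t \<le> x" "x \<le> a"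
      then have x: "x \<in> I" by (auto simp: I_def)
      have "((\<lambda>x. f x * exp (2 * L * x)) has_real_derivative
          (2 * (V x \<bullet> V' x) + 2 * L * f x) * exp (2 * L * x)) (at x)"
        by (auto intro!: derivative_eq_intros f x simp: algebra_simps)
      then show "\<exists>y. ((\<lambda>x. f x * exp (2 * L * x)) has_real_derivative y) (at x) \<and> y \<ge> 0"
        using f_le[OF x] by (intro exI conjI) (auto simp: zero_le_mult_iff)
    qed
    then show ?thesis using f0 by (simp add: mult_le_0_iff not_le)
  qed
  then have "f t = 0" using f_ge by linarith
  then show ?thesis by (simp add: f_def)
qed

text \<open>By linearity \<open>V - W\<close> solves the same system and vanishes at
  \<open>a\<close>. The bound on its derivative has the growth rate \<open>norm (A r) * K\<close>,
  where \<open>K\<close> is the constant of the bilinear product.\<close>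

lemma solves_system_unique:
  fixes A :: "real \<Rightarrow> real^2^2"
  assumes S: "is_interval S" "a \<in> S" "t \<in> S"
    and A: "continuous_on S A"
    and V: "\<And>r. r \<in> S \<Longrightarrow> solves_system A V r"
    and W: "\<And>r. r \<in> S \<Longrightarrow> solves_system A W r"
    and a: "V a = W a"
  shows "V t = W t"
proof -
  obtain K where K: "\<And>(A::real^2^2) x. norm (A *v x) \<le> norm A * norm x * K"
    using bounded_bilinear.bounded[OF bounded_bilinear_matrix_vector_mult] by blast
  have "V t - W t = 0"
  proof (rule zero_of_norm_derivative_le[OF S, where g = "\<lambda>r. norm (A r) * K"])
    show "continuous_on S (\<lambda>r. norm (A r) * K)"
      by (intro continuous_intros A)
    fix r assume r: "r \<in> S"
    show "((\<lambda>r. V r - W r) has_vector_derivative A r *v (V r - W r)) (at r)"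
      using V[OF r] W[OF r] unfolding solves_system_def matrix_vector_mult_diff_distrib
      by (rule has_vector_derivative_diff)
    show "norm (A r *v (V r - W r)) \<le> norm (A r) * K * norm (V r - W r)"
      using K[of "A r" "V r - W r"] by (simp add: mult_ac)
  qed (simp add: a)
  then show ?thesis by simp
qed

section \<open>Power series solutions and growth of their coefficients\<close>

text \<open>Termwise differentiation turns the left side of \<open>rec\<close> into the coefficients
  of the derivative, and the right side is the convolution given by the Cauchy product of the two
  series. The argument runs in each component \<open>i\<close>, with a finite sum over
  \<open>j\<close> for the matrix product.\<close>

lemma power_series_solves_linear_system:
  fixes A :: "nat \<Rightarrow> real^'n^'n" and w :: "nat \<Rightarrow> real^'n"
  assumes A: "\<And>x. \<bar>x\<bar> < R \<Longrightarrow> summable (\<lambda>m. norm (x^m *\<^sub>R A m))"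
    and w: "\<And>x. \<bar>x\<bar> < R \<Longrightarrow> summable (\<lambda>m. norm (x^m *\<^sub>R w m))"
    and rec: "\<And>m. real (Suc m) *\<^sub>R w (Suc m) = (\<Sum>k\<le>m. A (m - k) *v w k)"
    and r: "r \<in> ball x\<^sub>0 R"
  shows "((\<lambda>r. \<Sum>m. (r - x\<^sub>0)^m *\<^sub>R w m) has_vector_derivative
    (\<Sum>m. (r - x\<^sub>0)^m *\<^sub>R A m) *v (\<Sum>m. (r - x\<^sub>0)^m *\<^sub>R w m)) (at r)"
  unfolding has_vector_derivative_vec
proof
  fix i
  define y where "y = r - x\<^sub>0"
  have y: "\<bar>y\<bar> < R" using r by (auto simp: y_def dist_real_def)
  have A_norm: "summable (\<lambda>m. norm (A m $ i $ j * y^m))" for j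
    by (rule summable_comparison_test'[OF A[OF y], of 0])
      (auto simp: abs_mult power_abs mult.commute[of "\<bar>A _ $ _ $ _\<bar>"]
        intro!: mult_left_mono order.trans[OF component_le_norm_cart Finite_Cartesian_Product.norm_nth_le])
  have w_norm: "summable (\<lambda>m. norm (w m $ j * x^m))" if "\<bar>x\<bar> < R" for j x
    by (rule summable_comparison_test'[OF w[OF that], of 0])
      (auto simp: abs_mult power_abs mult.commute[of "\<bar>w _ $ _\<bar>"]
        intro!: mult_left_mono component_le_norm_cart)
  have w_sum: "(\<Sum>m. x^m *\<^sub>R w m) $ j = (\<Sum>m. w m $ j * x^m)" if "\<bar>x\<bar> < R" for x j
    using bounded_linear.suminf[OF bounded_linear_vec_nth summable_norm_cancel[OF w[OF that]], of j]
    by (simp add: mult.commute)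
  have A_sum: "(\<Sum>m. y^m *\<^sub>R A m) $ i $ j = (\<Sum>m. A m $ i $ j * y^m)" for j
  proof -
    have "bounded_linear (\<lambda>X::real^'n^'n. X $ i $ j)"
      by (intro bounded_linear_compose[OF bounded_linear_vec_nth bounded_linear_vec_nth])
    from bounded_linear.suminf[OF this summable_norm_cancel[OF A[OF y]]]
    show ?thesis by (simp add: mult.commute)
  qed
  have "((\<lambda>x. \<Sum>m. w m $ i * x^m) has_real_derivative (\<Sum>m. diffs (\<lambda>m. w m $ i) m * y^m)) (at y)"
    using y by (intro termdiffs_strong'[where K = R]) (auto intro!: summable_norm_cancel[OF w_norm])
  moreover have "diffs (\<lambda>m. w m $ i) m * y^m =
      (\<Sum>j\<in>UNIV. \<Sum>k\<le>m. (w k $ j * y^k) * (A (m - k) $ i $ j * y^(m-k)))" for m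
  proof -
    have "diffs (\<lambda>m. w m $ i) m = (real (Suc m) *\<^sub>R w (Suc m)) $ i"
      by (simp add: diffs_def)
    also have "\<dots> = (\<Sum>j\<in>UNIV. \<Sum>k\<le>m. A (m - k) $ i $ j * w k $ j)"
      unfolding rec by (simp add: matrix_vector_mult_def sum.swap[of _ UNIV])
    finally have "diffs (\<lambda>m. w m $ i) m * y^m =
        (\<Sum>j\<in>UNIV. \<Sum>k\<le>m. A (m - k) $ i $ j * w k $ j * y^m)"
      by (simp add: sum_distrib_right)
    also have "\<dots> = (\<Sum>j\<in>UNIV. \<Sum>k\<le>m. (w k $ j * y^k) * (A (m - k) $ i $ j * y^(m-k)))"
    proof (intro sum.cong refl)
      fix j k assume "k \<in> {..m}"
      then have "y^m = y^k * y^(m-k)" by (simp add: power_add[symmetric])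
      then show "A (m - k) $ i $ j * w k $ j * y^m =
          (w k $ j * y^k) * (A (m - k) $ i $ j * y^(m-k))" by simp
    qed
    finally show ?thesis .
  qed
  moreover have "(\<lambda>m. \<Sum>j\<in>UNIV. \<Sum>k\<le>m. (w k $ j * y^k) * (A (m - k) $ i $ j * y^(m-k))) sums
      (\<Sum>j\<in>UNIV. (\<Sum>m. w m $ j * y^m) * (\<Sum>m. A m $ i $ j * y^m))"
    by (intro sums_sum Cauchy_product_sums A_norm w_norm y)
  ultimately have "((\<lambda>x. \<Sum>m. w m $ i * x^m) has_real_derivative
      ((\<Sum>m. y^m *\<^sub>R A m) *v (\<Sum>m. y^m *\<^sub>R w m)) $ i) (at (r - x\<^sub>0))"
    by (simp add: sums_iff matrix_vector_mult_def A_sum w_sum[OF y] y_def[symmetric]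
        mult.commute[of "\<Sum>m. A m $ i $ _ * y^m"])
  then have "((\<lambda>r. \<Sum>m. w m $ i * (r - x\<^sub>0)^m) has_real_derivative
      ((\<Sum>m. y^m *\<^sub>R A m) *v (\<Sum>m. y^m *\<^sub>R w m)) $ i) (at r)"
    using DERIV_shift[of "\<lambda>x. \<Sum>m. w m $ i * x^m" _ r "- x\<^sub>0"] by simp
  then show "((\<lambda>r. (\<Sum>m. (r - x\<^sub>0)^m *\<^sub>R w m) $ i) has_real_derivative
      ((\<Sum>m. (r - x\<^sub>0)^m *\<^sub>R A m) *v (\<Sum>m. (r - x\<^sub>0)^m *\<^sub>R w m)) $ i) (at r)"
    unfolding y_def
  proof (rule has_field_derivative_transform_within_open[OF _ open_ball r])
    fix x assume "x \<in> ball x\<^sub>0 R"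
    then show "(\<Sum>m. w m $ i * (x - x\<^sub>0)^m) = (\<Sum>m. (x - x\<^sub>0)^m *\<^sub>R w m) $ i"
      by (intro w_sum[symmetric]) (auto simp: dist_real_def)
  qed
qed

text \<open>At distance \<open>d/2\<close> from the centre the series converges, so its terms are
  bounded by some \<open>N\<close>. Halving the radius is the price for this geometric
  bound.\<close>

lemma has_power_series_at_coeff_bound:
  assumes "has_power_series_at f a x"
  obtains \<delta> N where "\<delta> > 0" "N > 0" "\<And>m. norm (a m) \<le> N / \<delta>^m"
    "\<And>r. r \<in> ball x \<delta> \<Longrightarrow> (\<lambda>m. (r - x)^m *\<^sub>R a m) sums f r"
proof -
  obtain d where d: "d > 0" "\<And>r. r \<in> ball x d \<Longrightarrow> (\<lambda>m. (r - x)^m *\<^sub>R a m) sums f r"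
    using assms unfolding has_power_series_at_def by blast
  have "summable (\<lambda>m. (d/2)^m *\<^sub>R a m)"
    using d(2)[of "x + d/2"] d(1) by (auto simp: dist_real_def sums_iff)
  from summable_LIMSEQ_zero[OF this] have "Bseq (\<lambda>m. (d/2)^m *\<^sub>R a m)"
    by (intro convergent_imp_Bseq convergentI)
  then obtain N where N: "N > 0" "\<And>m. norm ((d/2)^m *\<^sub>R a m) \<le> N"
    by (auto elim: BseqE)
  show thesis
  proof (rule that[of "d/2" N])
    show "norm (a m) \<le> N / (d/2)^m" for m
      using N(2)[of m] d(1) by (simp add: pos_le_divide_eq mult.commute)
  qed (use d N in auto)
qed

lemma summable_norm_of_geometric_bound:
  fixes a :: "nat \<Rightarrow> 'a::real_normed_vector"
  assumes t: "t > 0" and a: "\<And>m. norm (a m) \<le> D * t^m" and x: "\<bar>x\<bar> * t < 1"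
  shows "summable (\<lambda>m. norm (x^m *\<^sub>R a m))"
proof (rule summable_comparison_test'[where N = 0])
  show "summable (\<lambda>m. D * (\<bar>x\<bar> * t)^m)"
    using t x by (intro summable_mult summable_geometric) (auto simp: abs_mult)
  show "norm (norm (x^m *\<^sub>R a m)) \<le> D * (\<bar>x\<bar> * t)^m" for m
    using mult_left_mono[OF a[of m], of "\<bar>x\<bar>^m"]
    by (simp add: power_abs power_mult_distrib mult_ac)
qed

lemma C_coeff_Suc:
  "real (Suc m) *\<^sub>R C_coeff Am (Suc m) = (\<Sum>k\<le>m. Am (m - k) ** C_coeff Am k)"
  by (subst C_coeff.simps) (simp add: atLeast0AtMost)

text \<open>Strong induction. Each of the \<open>n + 1\<close> terms of the convolution is at most
  \<open>K * N * (D * t^n)\<close>: since \<open>1 / \<delta> \<le> t\<close>, the powers of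
  \<open>t\<close> in the two factors combine to \<open>t^n\<close>. The factor \<open>n + 1\<close>
  cancels against the one on the left, and \<open>K * N \<le> t\<close> turns the remaining constant
  into one more power of \<open>t\<close>.\<close>

lemma C_coeff_bound:
  fixes Am :: "nat \<Rightarrow> real^2^2"
  assumes \<delta>: "\<delta> > 0" and N: "\<And>m. norm (Am m) \<le> N / \<delta>^m"
  obtains t where "t \<ge> 1 / \<delta>" "\<And>m. norm (C_coeff Am m) \<le> norm (mat 1 :: real^2^2) * t^m"
proof -
  obtain K where K: "K \<ge> 0" "\<And>(A::real^2^2) (B::real^2^2). norm (A ** B) \<le> norm A * norm B * K"
    using bounded_bilinear.nonneg_bounded[OF bounded_bilinear_matrix_matrix_mult] by blast
  have N0: "N \<ge> 0" using order.trans[OF norm_ge_zero N[of 0]] by simp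
  define t where "t = max (1 / \<delta>) (K * N)"
  have t: "1 / \<delta> \<le> t" "K * N \<le> t" by (auto simp: t_def)
  have t0: "t > 0" using \<delta> t(1) by (metis less_le_trans zero_less_divide_1_iff)
  define D where "D = norm (mat 1 :: real^2^2)"
  have D0: "D \<ge> 0" by (simp add: D_def)
  have "norm (C_coeff Am m) \<le> D * t^m" for m
  proof (induction m rule: less_induct)
    case (less m)
    show ?case
    proof (cases m)
      case 0
      then show ?thesis by (simp add: C_coeff.simps D_def)
    next
      case (Suc n)
      have "real (Suc n) * norm (C_coeff Am m) = norm (\<Sum>k\<le>n. Am (n - k) ** C_coeff Am k)"
        unfolding Suc C_coeff_Suc[symmetric] by simp
      also have "\<dots> \<le> (\<Sum>k\<le>n. K * N * (D * t^n))"
      proof (rule sum_norm_le)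
        fix k assume k: "k \<in> {..n}"
        have "norm (Am (n - k)) \<le> N * (1 / \<delta>)^(n - k)"
          using N[of "n - k"] by (simp add: power_one_over)
        also have "\<dots> \<le> N * t^(n - k)"
          using t \<delta> N0 by (intro mult_left_mono power_mono) auto
        finally have "norm (Am (n - k)) * norm (C_coeff Am k) \<le> (N * t^(n - k)) * (D * t^k)"
          using less.IH[of k] k Suc N0 t0 by (intro mult_mono) auto
        also have "\<dots> = N * (D * t^n)"
          using k by (simp add: power_add[symmetric] mult_ac)
        finally have "norm (Am (n - k)) * norm (C_coeff Am k) * K \<le> N * (D * t^n) * K"
          using K(1) by (rule mult_right_mono)
        then show "norm (Am (n - k) ** C_coeff Am k) \<le> K * N * (D * t^n)"
          using K(2)[of "Am (n - k)" "C_coeff Am k"] by (simp add: mult_ac)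
      qed
      also have "\<dots> = real (Suc n) * (K * N * (D * t^n))" by simp
      finally have "norm (C_coeff Am m) \<le> K * N * (D * t^n)"
        by (subst (asm) mult_le_cancel_left_pos) auto
      also have "\<dots> \<le> t * (D * t^n)"
        using t(2) t0 D0 by (intro mult_right_mono) auto
      also have "\<dots> = D * t^m" by (simp add: Suc mult_ac)
      finally show ?thesis .
    qed
  qed
  with t(1) show thesis by (intro that) (auto simp: D_def)
qed

section \<open>The matrix series as a fundamental solution\<close>

lemma C_matrix_mult_eq:
  assumes "summable (\<lambda>m. (r - x)^m *\<^sub>R C_coeff Am m)"
  shows "C_matrix Am x r *v c = (\<Sum>m. (r - x)^m *\<^sub>R (C_coeff Am m *v c))"
  using bounded_linear.suminf[OF bounded_bilinear.bounded_linear_left[OF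
      bounded_bilinear_matrix_vector_mult[where 'n=2 and 'm=2], of c] assms]
  by (simp add: C_matrix_def scaleR_matrix_vector_assoc)

lemma C_matrix_center: "C_matrix Am x x = mat 1"
proof -
  \<comment> \<open>At the centre only the term \<open>m = 0\<close> survives, because
    \<open>0^0 = 1\<close>.\<close>
  have "C_matrix Am x x = (\<Sum>m. if m = 0 then C_coeff Am m else 0)"
    unfolding C_matrix_def by (intro suminf_cong) auto
  also have "\<dots> = mat 1"
    using sums_single[of 0 "C_coeff Am"] by (simp add: sums_iff C_coeff.simps)
  finally show ?thesis .
qed

text \<open>Multiplying the matrix recursion by \<open>c\<close> gives the vector recursion for
  \<open>C_coeff Am m *v c\<close>, so the result on vector power series applies.\<close>

lemma C_matrix_solves_system:
  assumes A: "\<And>x. \<bar>x\<bar> < R \<Longrightarrow> summable (\<lambda>m. norm (x^m *\<^sub>R Am m))"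
    and C: "\<And>x. \<bar>x\<bar> < R \<Longrightarrow> summable (\<lambda>m. norm (x^m *\<^sub>R C_coeff Am m))"
    and r: "r \<in> ball x\<^sub>0 R"
  shows "solves_system (\<lambda>r. \<Sum>m. (r - x\<^sub>0)^m *\<^sub>R Am m) (\<lambda>r. C_matrix Am x\<^sub>0 r *v c) r"
  unfolding solves_system_def
proof (rule has_vector_derivative_transform_within_open[OF _ open_ball r])
  obtain K where K: "\<And>(A::real^2^2) x. norm (A *v x) \<le> norm A * norm x * K"
    using bounded_bilinear.bounded[OF bounded_bilinear_matrix_vector_mult] by blast
  have eq: "(\<Sum>m. (x - x\<^sub>0)^m *\<^sub>R (C_coeff Am m *v c)) = C_matrix Am x\<^sub>0 x *v c"
    if "x \<in> ball x\<^sub>0 R" for x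
    using that by (intro C_matrix_mult_eq[symmetric] summable_norm_cancel[OF C])
      (auto simp: dist_real_def)
  then show "\<And>x. x \<in> ball x\<^sub>0 R \<Longrightarrow>
      (\<Sum>m. (x - x\<^sub>0)^m *\<^sub>R (C_coeff Am m *v c)) = C_matrix Am x\<^sub>0 x *v c" .
  have C_norm: "summable (\<lambda>m. norm (x^m *\<^sub>R (C_coeff Am m *v c)))" if "\<bar>x\<bar> < R" for x
  proof (rule summable_comparison_test'[where N = 0])
    show "summable (\<lambda>m. norm (x^m *\<^sub>R C_coeff Am m) * (norm c * K))"
      by (intro summable_mult2 C that)
    show "norm (norm (x^m *\<^sub>R (C_coeff Am m *v c))) \<le> norm (x^m *\<^sub>R C_coeff Am m) * (norm c * K)"
      for m
      using K[of "x^m *\<^sub>R C_coeff Am m" c]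
      by (simp add: scaleR_matrix_vector_assoc[symmetric] mult_ac)
  qed
  have rec: "real (Suc m) *\<^sub>R (C_coeff Am (Suc m) *v c) = (\<Sum>k\<le>m. Am (m - k) *v (C_coeff Am k *v c))" for m
    unfolding scaleR_matrix_vector_assoc C_coeff_Suc
    using linear_sum[OF bounded_linear.linear[OF bounded_bilinear.bounded_linear_left[OF
      bounded_bilinear_matrix_vector_mult[where 'n=2 and 'm=2], of c]]]
    by (simp add: matrix_vector_mul_assoc)
  show "((\<lambda>r. \<Sum>m. (r - x\<^sub>0)^m *\<^sub>R (C_coeff Am m *v c)) has_vector_derivative
      (\<Sum>m. (r - x\<^sub>0)^m *\<^sub>R Am m) *v (C_matrix Am x\<^sub>0 r *v c)) (at r)"
    using power_series_solves_linear_system[OF A C_norm rec r] by (simp add: eq[OF r])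
qed

text \<open>Each entry is a scalar power series convergent on the whole ball, hence differentiable
  there.\<close>

lemma continuous_on_power_series_matrix:
  fixes a :: "nat \<Rightarrow> real^'n^'m"
  assumes "\<And>r. r \<in> ball x \<delta> \<Longrightarrow> (\<lambda>m. (r - x)^m *\<^sub>R a m) sums f r"
  shows "continuous_on (ball x \<delta>) f"
proof -
  have "continuous_on (ball x \<delta>) (\<lambda>r. f r $ i $ j)" for i j
  proof -
    have s: "(\<lambda>m. a m $ i $ j * (r - x)^m) sums (f r $ i $ j)" if "r \<in> ball x \<delta>" for r
      using sums_vec_nth[OF sums_vec_nth[OF assms[OF that]]] by (simp add: mult.commute)
    have "continuous_on (ball x \<delta>) (\<lambda>r. \<Sum>m. a m $ i $ j * (r - x)^m)"
    proof (rule continuous_at_imp_continuous_on, rule ballI)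
      fix r assume r: "r \<in> ball x \<delta>"
      then have "((\<lambda>y. \<Sum>m. a m $ i $ j * y^m) has_real_derivative
          (\<Sum>m. diffs (\<lambda>m. a m $ i $ j) m * (r - x)^m)) (at (r - x))"
        using s[THEN sums_summable, of "x + _"]
        by (intro termdiffs_strong'[where K = \<delta>]) (auto simp: dist_real_def)
      from DERIV_isCont[OF this] show "isCont (\<lambda>r. \<Sum>m. a m $ i $ j * (r - x)^m) r"
        by (intro isCont_o2[where f = "\<lambda>r. r - x" and g = "\<lambda>y. \<Sum>m. a m $ i $ j * y^m"]) auto
    qed
    then show ?thesis
      by (rule continuous_on_eq) (use s in \<open>simp add: sums_iff\<close>)
  qed
  then have "continuous_on (ball x \<delta>) (\<lambda>r. \<chi> i j. f r $ i $ j)"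
    by (intro continuous_on_vec_lambda)
  then show ?thesis by simp
qed

section \<open>Regularity of the mass and the density\<close>

lemma mass_has_derivative:
  assumes r: "r > 0"
    and int: "\<forall>\<^sub>F x in nhds r. (\<lambda>x. \<mu> x * x^2) integrable_on {0..x}"
    and \<mu>: "isCont \<mu> r"
  shows "(mass \<mu> has_real_derivative \<mu> r * r^2 / 2) (at r)"
proof -
  obtain d where d: "d > 0" "\<And>x. dist x r < d \<Longrightarrow> (\<lambda>x. \<mu> x * x^2) integrable_on {0..x}"
    using int unfolding eventually_nhds_metric by blast
  \<comment> \<open>The interval reaches beyond \<open>r\<close>, so \<open>r\<close> is an interior
    point and the derivative within the interval is two-sided.\<close>
  have i: "(\<lambda>x. \<mu> x * x^2) integrable_on {0..r + d/2}"
    using d by (auto simp: dist_real_def)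
  have "isCont (\<lambda>x. \<mu> x * x^2) r"
    by (intro continuous_intros \<mu>)
  then have "((\<lambda>u. integral {0..u} (\<lambda>x. \<mu> x * x^2)) has_vector_derivative \<mu> r * r^2) (at r within {0..r + d/2})"
    using integral_has_vector_derivative_continuous_at[OF i, of r "{}"] r d(1)
    by (auto simp: continuous_at_imp_continuous_at_within)
  then have "((\<lambda>u. integral {0..u} (\<lambda>x. \<mu> x * x^2)) has_real_derivative \<mu> r * r^2) (at r)"
    using r d(1) by (simp add: has_real_derivative_iff_has_vector_derivative at_within_Icc_at)
  from DERIV_cmult[OF this, of "1/2"] show ?thesis
    by (simp add: mass_def[abs_def])
qed

text \<open>This starts a bootstrap: integrability makes the mass continuous,
  \<open>isCont_mu\<close> then makes the density continuous, and \<open>mass_has_derivative\<close>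
  finally makes the mass differentiable.\<close>

lemma isCont_mass:
  assumes r: "r > 0"
    and int: "\<forall>\<^sub>F x in nhds r. (\<lambda>x. \<mu> x * x^2) integrable_on {0..x}"
  shows "isCont (mass \<mu>) r"
proof -
  obtain d where d: "d > 0" "\<And>x. dist x r < d \<Longrightarrow> (\<lambda>x. \<mu> x * x^2) integrable_on {0..x}"
    using int unfolding eventually_nhds_metric by blast
  have "(\<lambda>x. \<mu> x * x^2) integrable_on {0..r + d/2}"
    using d by (auto simp: dist_real_def)
  then have "continuous_on {0..r + d/2} (mass \<mu>)"
    unfolding mass_def[abs_def] by (intro continuous_intros indefinite_integral_continuous_1)
  then show ?thesis
    using r d(1) by (intro continuous_on_interior[of "{0..r + d/2}"]) (auto simp: interior_atLeastAtMost_real)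
qed

lemma phi_squared:
  assumes "r > 0" "r > 2 * mass \<mu> r"
  shows "(phi \<mu> r)^2 = 4 / r^2 * (1 - 2 * mass \<mu> r / r)"
  using assms by (simp add: phi_def power_mult_distrib power_divide field_simps)

text \<open>The coefficient \<open>6 \<E> / (r\<^sup>2 \<phi>\<^sup>2)\<close> of the system determines \<open>\<mu>\<close> from the mass.\<close>

lemma mu_eq_sys_matrix:
  assumes "r > 0" "r > 2 * mass \<mu> r"
  shows "\<mu> r = 2 * sys_matrix \<mu> r $ 1 $ 2 * (1 - 2 * mass \<mu> r / r) + 6 * mass \<mu> r / r^3"
proof -
  have "1 - 2 * mass \<mu> r / r \<noteq> 0" using assms by simp
  then have "2 * sys_matrix \<mu> r $ 1 $ 2 * (1 - 2 * mass \<mu> r / r) = 3 * calE \<mu> r"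
    using assms by (simp add: sys_matrix_def phi_squared) (simp add: field_simps)
  then show ?thesis by (simp add: calE_def)
qed

text \<open>Near \<open>r\<close> the formula of \<open>mu_eq_sys_matrix\<close> expresses the
  density through the mass and one matrix entry, both continuous at \<open>r\<close>.\<close>

lemma isCont_mu:
  assumes r: "r > 0" "\<forall>\<^sub>F x in nhds r. x > 2 * mass \<mu> x"
    and m: "isCont (mass \<mu>) r" and A: "isCont (sys_matrix \<mu>) r"
  shows "isCont \<mu> r"
proof -
  have "isCont (\<lambda>x. 2 * sys_matrix \<mu> x $ 1 $ 2 * (1 - 2 * mass \<mu> x / x) + 6 * mass \<mu> x / x^3) r"
    using r(1) by (intro continuous_intros m A) auto
  moreover have "\<forall>\<^sub>F x in nhds r. \<mu> x = 2 * sys_matrix \<mu> x $ 1 $ 2 * (1 - 2 * mass \<mu> x / x) + 6 * mass \<mu> x / x^3"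
    using r(2) eventually_nhds_in_open[OF open_greaterThan r(1)[folded greaterThan_iff]]
    by eventually_elim (rule mu_eq_sys_matrix, simp_all)
  ultimately show ?thesis by (subst isCont_cong)
qed

section \<open>The Riccati equation and the change of variables\<close>

text \<open>The quotient \<open>s / u\<close> of the new variables, expressed through \<open>p\<close>.\<close>

definition log_slope :: "(real \<Rightarrow> real) \<Rightarrow> (real \<Rightarrow> real) \<Rightarrow> real \<Rightarrow> real" where
  "log_slope \<mu> p r = r / (2 * (1 - 2 * mass \<mu> r / r)) * (p r + 2 * mass \<mu> r / r^3)"

text \<open>The square root in \<open>phi\<close> disappears: dividing \<open>calA\<close> by
  \<open>phi\<close> once more leaves only \<open>(phi \<mu> r)^2\<close>, which is rational in
  \<open>r\<close> and the mass.\<close>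

lemma new_variables_iff:
  assumes r: "r > 0" "r > 2 * mass \<mu> r"
  shows "new_variables \<mu> p s u r \<longleftrightarrow>
    u r \<noteq> 0 \<and> (u has_real_derivative s r) (at r) \<and> s r = log_slope \<mu> p r * u r"
proof -
  have "2 * calA \<mu> p r / (r * phi \<mu> r) = 2 / (r * (phi \<mu> r)^2) * (p r + 2 * mass \<mu> r / r^3)"
    by (simp add: calA_def power2_eq_square)
  also have "2 / (r * (phi \<mu> r)^2) = r / (2 * (1 - 2 * mass \<mu> r / r))"
    using r by (simp add: phi_squared[OF r]) (simp add: power2_eq_square field_simps)
  finally have "2 * calA \<mu> p r / (r * phi \<mu> r) = log_slope \<mu> p r"
    by (simp add: log_slope_def)
  then show ?thesis
    unfolding new_variables_def by (auto simp: field_simps)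
qed

text \<open>Write the log-slope as \<open>F / G\<close> with \<open>F = r^3 p + 2 M\<close> and
  \<open>G = 2 r (r - 2 M)\<close>. Let \<open>T\<close> be the TOV value of \<open>p'\<close> and
  \<open>R\<close> the Riccati value of \<open>Q'\<close>. The identity \<open>key\<close> says that
  the derivative of \<open>Q G = F\<close> is consistent with these two values. One direction is the
  quotient rule for \<open>F / G\<close>, the other the quotient rule for
  \<open>p = (Q G - 2 M) / r^3\<close>.\<close>

lemma TOV_iff_riccati:
  assumes r: "r > 0" "r > 2 * mass \<mu> r"
    and m: "(mass \<mu> has_real_derivative \<mu> r * r^2 / 2) (at r)"
  shows "TOV \<mu> p r \<longleftrightarrow> (log_slope \<mu> p has_real_derivative
    sys_matrix \<mu> r $ 1 $ 1 * log_slope \<mu> p r + sys_matrix \<mu> r $ 1 $ 2 - (log_slope \<mu> p r)^2) (at r)"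
    (is "_ \<longleftrightarrow> (_ has_real_derivative ?R) _")
proof -
  define M where "M = mass \<mu> r"
  define d where "d = r - 2 * M"
  define Q where "Q = log_slope \<mu> p r"
  define R where "R = sys_matrix \<mu> r $ 1 $ 1 * Q + sys_matrix \<mu> r $ 1 $ 2 - Q^2"
  define T where "T = - ((\<mu> r + p r) * Q)"
  define F where "F = (\<lambda>x. x^3 * p x + 2 * mass \<mu> x)"
  define G where "G = (\<lambda>x. 2 * (x^2 - 2 * x * mass \<mu> x))"
  define G' where "G' = 4 * r - 4 * M - 2 * \<mu> r * r^3"
  have d: "d > 0" using r by (simp add: d_def M_def)
  have h: "1 - 2 * M / r = d / r" using r by (simp add: d_def field_simps)
  have G_r: "G r = 2 * r * d" by (simp add: G_def d_def M_def power2_eq_square algebra_simps)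
  \<comment> \<open>The first row of the matrix, cleared of denominators by the factor
    \<open>G r = 2 * r * d\<close>.\<close>
  have a: "sys_matrix \<mu> r $ 1 $ 1 * (2 * r * d) = 2 * d + r^3 * \<mu> r - 2 * M"
    using r d by (simp add: sys_matrix_def phi_squared calE_def M_def[symmetric] h)
      (simp add: field_simps power2_eq_square power3_eq_cube)
  have b: "sys_matrix \<mu> r $ 1 $ 2 * (2 * r * d) = r^2 * \<mu> r - 6 * M / r"
    using r d by (simp add: sys_matrix_def phi_squared calE_def M_def[symmetric] h)
      (simp add: field_simps power2_eq_square power3_eq_cube)
  \<comment> \<open>Derivatives at \<open>r\<close> depend on nearby values, so positivity is
    extended to a neighbourhood, where the quotient formulas for \<open>Q\<close> and
    \<open>p\<close> hold.\<close>
  have near: "\<forall>\<^sub>F x in nhds r. x > 0 \<and> x > 2 * mass \<mu> x"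
  proof -
    have "isCont (\<lambda>x. x - 2 * mass \<mu> x) r"
      by (intro continuous_intros DERIV_isCont[OF m])
    then have "((\<lambda>x. x - 2 * mass \<mu> x) \<longlongrightarrow> r - 2 * mass \<mu> r) (nhds r)"
      unfolding isCont_def by (rule tendsto_at_iff_tendsto_nhds[THEN iffD1])
    then have "\<forall>\<^sub>F x in nhds r. x - 2 * mass \<mu> x > 0"
      by (rule order_tendstoD(1)) (use r in simp)
    then show ?thesis
      using eventually_nhds_in_open[OF open_greaterThan r(1)[folded greaterThan_iff]]
      by eventually_elim simp
  qed
  have Q_eq: "log_slope \<mu> p x = F x / G x" and p_eq: "p x = (log_slope \<mu> p x * G x - 2 * mass \<mu> x) / x^3"
    if x: "x > 0 \<and> x > 2 * mass \<mu> x" for x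
  proof -
    have h: "1 - 2 * mass \<mu> x / x = (x - 2 * mass \<mu> x) / x" and G: "G x = 2 * x * (x - 2 * mass \<mu> x)"
      using x by (auto simp: G_def field_simps power2_eq_square)
    have F: "p x + 2 * mass \<mu> x / x^3 = F x / x^3"
      using x by (simp add: F_def field_simps)
    show Q: "log_slope \<mu> p x = F x / G x"
      using x unfolding log_slope_def h G F by (simp add: power3_eq_cube)
    have "G x \<noteq> 0" using x G by simp
    then show "p x = (log_slope \<mu> p x * G x - 2 * mass \<mu> x) / x^3"
      using x unfolding Q by (simp add: F_def)
  qed
  have p_r: "r^3 * p r = Q * (2 * r * d) - 2 * M"
  proof -
    have "p r = (Q * (2 * r * d) - 2 * M) / r^3"
      using p_eq[of r] r unfolding G_r Q_def M_def by blast
    then show ?thesis using r by simp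
  qed
  have T_eq: "- (r^2 * (\<mu> r + p r) / (2 * (r - 2 * mass \<mu> r))) * (p r + 2 * mass \<mu> r / r^3) = T"
    using r d unfolding T_def Q_def log_slope_def M_def[symmetric] d_def[symmetric] h
    by (simp add: power2_eq_square mult_ac)
  have G': "(G has_real_derivative G') (at r)"
    unfolding G_def G'_def
    by (auto intro!: derivative_eq_intros m simp: M_def algebra_simps power2_eq_square power3_eq_cube)
  have R_eq: "R * (2 * r * d) = 2 * d * Q + r^3 * \<mu> r * Q - 2 * M * Q + r^2 * \<mu> r - 6 * M / r - Q^2 * (2 * r * d)"
  proof -
    have "R * (2 * r * d) = (sys_matrix \<mu> r $ 1 $ 1 * (2 * r * d)) * Q +
        sys_matrix \<mu> r $ 1 $ 2 * (2 * r * d) - Q^2 * (2 * r * d)"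
      by (simp add: R_def algebra_simps)
    then show ?thesis unfolding a b by (simp add: algebra_simps)
  qed
  have "r^3 * T = - \<mu> r * r^3 * Q - (r^3 * p r) * Q"
    by (simp add: T_def algebra_simps)
  moreover have "3 * r^2 * p r = 3 / r * (r^3 * p r)"
    using r by (simp add: power2_eq_square power3_eq_cube)
  moreover have "3 / r * (Q * (2 * r * d) - 2 * M) = 6 * d * Q - 6 * M / r"
    using r by (simp add: field_simps)
  \<comment> \<open>The left side is the product rule for \<open>Q G\<close> with
    \<open>Q' = R\<close>; the right side is \<open>F'\<close> with \<open>p' = T\<close> and
    \<open>2 M' = \<mu> r^2\<close>.\<close>
  ultimately have key: "R * G r + Q * G' = 3 * r^2 * p r + r^3 * T + \<mu> r * r^2"
    unfolding G_r R_eq p_r by (simp add: G'_def d_def algebra_simps power2_eq_square)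
  show ?thesis
    unfolding Q_def[symmetric] R_def[symmetric]
  proof
    assume "TOV \<mu> p r"
    then have p: "(p has_real_derivative T) (at r)"
      unfolding TOV_def T_eq .
    have "(F has_real_derivative 3 * r^2 * p r + r^3 * T + \<mu> r * r^2) (at r)"
      unfolding F_def by (auto intro!: derivative_eq_intros p m)
    then have "((\<lambda>x. F x / G x) has_real_derivative ((R * G r + Q * G') * G r - F r * G') / (G r * G r)) (at r)"
      unfolding key using r d by (intro DERIV_divide G') (simp_all add: G_r)
    also have "((R * G r + Q * G') * G r - F r * G') / (G r * G r) = R"
    proof -
      have "G r \<noteq> 0" using r d by (simp add: G_r)
      moreover from this have "F r = Q * G r"
        using Q_eq[of r] r by (simp add: Q_def)
      ultimately show ?thesis by (simp add: field_simps)
    qed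
    finally show "(log_slope \<mu> p has_real_derivative R) (at r)"
      by (rule DERIV_cong_ev[OF refl _ refl, THEN iffD2, rotated])
        (use near in \<open>auto elim!: eventually_mono simp: Q_eq\<close>)
  next
    assume q: "(log_slope \<mu> p has_real_derivative R) (at r)"
    have num: "((\<lambda>x. log_slope \<mu> p x * G x - 2 * mass \<mu> x) has_real_derivative 3 * r^2 * p r + r^3 * T) (at r)"
      using DERIV_diff[OF DERIV_mult[OF q G'] DERIV_cmult[OF m, of 2]] key
      by (simp add: Q_def mult.commute[of _ G'] diff_eq_eq)
    have num_r: "log_slope \<mu> p r * G r - 2 * mass \<mu> r = r^3 * p r"
      unfolding p_r by (simp add: Q_def G_r M_def)
    have "((\<lambda>x. x^3) has_real_derivative 3 * r^2) (at r)"
      by (auto intro!: derivative_eq_intros)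
    from DERIV_divide[OF num this]
    have "((\<lambda>x. (log_slope \<mu> p x * G x - 2 * mass \<mu> x) / x^3) has_real_derivative
        ((3 * r^2 * p r + r^3 * T) * r^3 - (r^3 * p r) * (3 * r^2)) / (r^3 * r^3)) (at r)"
      unfolding num_r using r by simp
    also have "((3 * r^2 * p r + r^3 * T) * r^3 - (r^3 * p r) * (3 * r^2)) / (r^3 * r^3) = T"
      using r by (simp add: field_simps)
    finally have "(p has_real_derivative T) (at r)"
      by (rule DERIV_cong_ev[OF refl _ refl, THEN iffD2, rotated])
        (use near in \<open>auto elim!: eventually_mono simp: p_eq[symmetric]\<close>)
    then show "TOV \<mu> p r"
      unfolding TOV_def T_eq .
  qed
qed

lemma solves_sys_matrix_iff:
  "solves_system (sys_matrix \<mu>) (\<lambda>r. vector [s r, u r]) r \<longleftrightarrow>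
    (s has_real_derivative sys_matrix \<mu> r $ 1 $ 1 * s r + sys_matrix \<mu> r $ 1 $ 2 * u r) (at r) \<and>
    (u has_real_derivative s r) (at r)"
proof -
  have "sys_matrix \<mu> r *v vector [s r, u r] =
      vector [sys_matrix \<mu> r $ 1 $ 1 * s r + sys_matrix \<mu> r $ 1 $ 2 * u r, s r]"
    by (simp add: vec_eq_iff forall_2 matrix_vector_mult_def sum_2 sys_matrix_def)
  then show ?thesis
    by (simp add: solves_system_def has_vector_derivative_vec forall_2)
qed

text \<open>With \<open>s = Q u\<close> and \<open>u' = s\<close>, the Riccati equation gives
  \<open>s' = (a Q + b - Q^2) u + Q s = a s + b u\<close>. Conversely, \<open>Q = s / u\<close> is
  differentiated by the quotient rule.\<close>

lemma TOV_iff_solves_system: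
  assumes S: "open S" "r \<in> S"
    and pos: "\<And>x. x \<in> S \<Longrightarrow> x > 0 \<and> x > 2 * mass \<mu> x"
    and m: "(mass \<mu> has_real_derivative \<mu> r * r^2 / 2) (at r)"
    and nv: "\<And>x. x \<in> S \<Longrightarrow> new_variables \<mu> p s u x"
  shows "TOV \<mu> p r \<longleftrightarrow> solves_system (sys_matrix \<mu>) (\<lambda>r. vector [s r, u r]) r"
proof -
  let ?Q = "log_slope \<mu> p" and ?a = "sys_matrix \<mu> r $ 1 $ 1" and ?b = "sys_matrix \<mu> r $ 1 $ 2"
  have nv': "u x \<noteq> 0" "(u has_real_derivative s x) (at x)" "s x = ?Q x * u x" if "x \<in> S" for x
    using nv[OF that] pos[OF that] new_variables_iff by auto
  note u = nv'(1)[OF S(2)] nv'(2)[OF S(2)] and s = nv'(3)[OF S(2)]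
  have "(?Q has_real_derivative ?a * ?Q r + ?b - (?Q r)^2) (at r) \<longleftrightarrow>
      (s has_real_derivative ?a * s r + ?b * u r) (at r)"
  proof
    assume "(?Q has_real_derivative ?a * ?Q r + ?b - (?Q r)^2) (at r)"
    then have "((\<lambda>x. ?Q x * u x) has_real_derivative ?a * s r + ?b * u r) (at r)"
      by (auto intro!: derivative_eq_intros u simp: s algebra_simps power2_eq_square)
    then show "(s has_real_derivative ?a * s r + ?b * u r) (at r)"
      by (rule has_field_derivative_transform_within_open[OF _ S]) (simp add: nv')
  next
    assume "(s has_real_derivative ?a * s r + ?b * u r) (at r)"
    then have "((\<lambda>x. s x / u x) has_real_derivative ?a * ?Q r + ?b - (?Q r)^2) (at r)"
      using u(1) by (auto intro!: derivative_eq_intros u simp: s field_simps power2_eq_square)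
    then show "(?Q has_real_derivative ?a * ?Q r + ?b - (?Q r)^2) (at r)"
      by (rule has_field_derivative_transform_within_open[OF _ S]) (simp add: nv')
  qed
  then show ?thesis
    using pos[OF S(2)] m u(2) by (simp add: TOV_iff_riccati solves_sys_matrix_iff)
qed

text \<open>Both \<open>w = s - Q u\<close>, where \<open>Q\<close> is the log-slope, and \<open>u\<close> solve scalar linear equations,
  \<open>w' = (a - Q) w\<close> (by the Riccati equation of \<open>Q\<close>) and, once \<open>w = 0\<close>, \<open>u' = Q u\<close>.\<close>

lemma new_variables_of_solution:
  assumes S: "is_interval S" "x\<^sub>0 \<in> S" "r \<in> S"
    and pos: "\<And>x. x \<in> S \<Longrightarrow> x > 0 \<and> x > 2 * mass \<mu> x"
    and A: "continuous_on S (sys_matrix \<mu>)"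
    and m: "\<And>x. x \<in> S \<Longrightarrow> (mass \<mu> has_real_derivative \<mu> x * x^2 / 2) (at x)"
    and TOV: "\<And>x. x \<in> S \<Longrightarrow> TOV \<mu> p x"
    and sol: "\<And>x. x \<in> S \<Longrightarrow> solves_system (sys_matrix \<mu>) (\<lambda>r. vector [s r, u r]) x"
    and u0: "u x\<^sub>0 \<noteq> 0" and s0: "s x\<^sub>0 = log_slope \<mu> p x\<^sub>0 * u x\<^sub>0"
  shows "new_variables \<mu> p s u r"
proof -
  let ?Q = "log_slope \<mu> p" and ?a = "\<lambda>x. sys_matrix \<mu> x $ 1 $ 1" and ?b = "\<lambda>x. sys_matrix \<mu> x $ 1 $ 2"
  have Q: "(?Q has_real_derivative ?a x * ?Q x + ?b x - (?Q x)^2) (at x)" if "x \<in> S" for x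
    using TOV[OF that] TOV_iff_riccati[OF _ _ m[OF that]] pos[OF that] by blast
  then have Q_cont: "continuous_on S ?Q"
    by (meson DERIV_isCont continuous_at_imp_continuous_on)
  have s: "(s has_real_derivative ?a x * s x + ?b x * u x) (at x)"
    and u: "(u has_real_derivative s x) (at x)" if "x \<in> S" for x
    using sol[OF that] by (auto simp: solves_sys_matrix_iff)
  have w: "s x = ?Q x * u x" if x: "x \<in> S" for x
  proof -
    have "s x - ?Q x * u x = 0"
    proof (rule zero_of_norm_derivative_le[OF S(1,2) x, where g = "\<lambda>x. \<bar>?a x - ?Q x\<bar>"])
      show "continuous_on S (\<lambda>x. \<bar>?a x - ?Q x\<bar>)"
        by (intro continuous_intros A Q_cont)
      fix y assume y: "y \<in> S"
      show "((\<lambda>x. s x - ?Q x * u x) has_vector_derivative (?a y - ?Q y) * (s y - ?Q y * u y)) (at y)"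
        unfolding has_real_derivative_iff_has_vector_derivative[symmetric]
        by (auto intro!: derivative_eq_intros s[OF y] u[OF y] Q[OF y] simp: algebra_simps power2_eq_square)
    qed (auto simp: s0 abs_mult)
    then show ?thesis by simp
  qed
  have "u r \<noteq> 0"
  proof
    assume "u r = 0"
    \<comment> \<open>The uniqueness estimate is run from \<open>r\<close> back to
      \<open>x\<^sub>0\<close>: a zero of \<open>u\<close> at \<open>r\<close> would propagate to
      \<open>x\<^sub>0\<close>.\<close>
    then have "u x\<^sub>0 = 0"
    proof (rule zero_of_norm_derivative_le[OF S(1,3,2), where g = "\<lambda>x. \<bar>?Q x\<bar>" and V' = s, rotated 3])
      show "continuous_on S (\<lambda>x. \<bar>?Q x\<bar>)"
        by (intro continuous_intros Q_cont)
      fix y assume y: "y \<in> S"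
      show "(u has_vector_derivative s y) (at y)"
        using u[OF y] by (simp add: has_real_derivative_iff_has_vector_derivative)
      show "norm (s y) \<le> \<bar>?Q y\<bar> * norm (u y)"
        by (simp add: w[OF y] abs_mult)
    qed
    with u0 show False by simp
  qed
  then show ?thesis
    using pos[OF S(3)] u[OF S(3)] w[OF S(3)] by (simp add: new_variables_iff)
qed

section \<open>Local solution of the system and the integration constants\<close>

theorem mainTheorem6:
  fixes \<mu> :: "real \<Rightarrow> real" and r\<^sub>J :: real and Am :: "nat \<Rightarrow> real^2^2"
  assumes "r\<^sub>J > 0"
    and "\<forall>\<^sub>F r in nhds r\<^sub>J. (\<lambda>x. \<mu> x * x^2) integrable_on {0..r}"
    and "\<forall>\<^sub>F r in nhds r\<^sub>J. r > 2 * mass \<mu> r"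
    and "has_power_series_at (sys_matrix \<mu>) Am r\<^sub>J"
  shows
    "\<exists>\<rho>>0.
       (\<forall>r\<in>ball r\<^sub>J \<rho>. summable (\<lambda>m. (r - r\<^sub>J)^m *\<^sub>R C_coeff Am m)) \<and>
       (\<forall>\<eta>. 0 < \<eta> \<and> \<eta> \<le> \<rho> \<longrightarrow>
          (\<forall>p s u. (\<forall>r\<in>ball r\<^sub>J \<eta>. new_variables \<mu> p s u r) \<longrightarrow>
             ((\<forall>r\<in>ball r\<^sub>J \<eta>. TOV \<mu> p r) \<longleftrightarrow>
              (\<forall>r\<in>ball r\<^sub>J \<eta>. solves_system (sys_matrix \<mu>) (\<lambda>r. vector [s r, u r]) r))) \<and>
          (\<forall>W :: real \<Rightarrow> real^2.
             (real_analytic_at W r\<^sub>J \<and> (\<forall>r\<in>ball r\<^sub>J \<eta>. solves_system (sys_matrix \<mu>) W r)) \<longleftrightarrow>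
             (\<exists>c\<^sub>1 c\<^sub>2. \<forall>r\<in>ball r\<^sub>J \<eta>. W r = C_matrix Am r\<^sub>J r *v vector [c\<^sub>1, c\<^sub>2])) \<and>
          (\<forall>p. (\<forall>r\<in>ball r\<^sub>J \<eta>. TOV \<mu> p r) \<longrightarrow>
             (\<forall>c\<^sub>1. (\<forall>r\<in>ball r\<^sub>J \<eta>.
                       new_variables \<mu> p
                         (\<lambda>r. (C_matrix Am r\<^sub>J r *v vector [c\<^sub>1, 1]) $ 1)
                         (\<lambda>r. (C_matrix Am r\<^sub>J r *v vector [c\<^sub>1, 1]) $ 2) r) \<longleftrightarrow>
                   c\<^sub>1 = r\<^sub>J / (2 * (1 - 2 * mass \<mu> r\<^sub>J / r\<^sub>J)) *
                          (p r\<^sub>J + 2 * mass \<mu> r\<^sub>J / r\<^sub>J^3))))"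
proof -
  have rJ: "r\<^sub>J > 0" by fact
  obtain \<delta> N where \<delta>: "\<delta> > 0" "N > 0" "\<And>m. norm (Am m) \<le> N / \<delta>^m"
    and sums: "\<And>r. r \<in> ball r\<^sub>J \<delta> \<Longrightarrow> (\<lambda>m. (r - r\<^sub>J)^m *\<^sub>R Am m) sums sys_matrix \<mu> r"
    using has_power_series_at_coeff_bound[OF assms(4)] by blast
  obtain t where t: "t \<ge> 1 / \<delta>"
    and Cm: "\<And>m. norm (C_coeff Am m) \<le> norm (mat 1 :: real^2^2) * t^m"
    using C_coeff_bound[OF \<delta>(1,3)] by blast
  obtain d where d: "d > 0" "\<And>r. r \<in> ball r\<^sub>J d \<Longrightarrow> (\<lambda>x. \<mu> x * x^2) integrable_on {0..r} \<and> r > 2 * mass \<mu> r"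
    using eventually_conj[OF assms(2,3)] unfolding eventually_nhds_metric
    by (auto simp: dist_commute)
  have t0: "t > 0" using \<delta>(1) t by (metis less_le_trans zero_less_divide_1_iff)
  \<comment> \<open>The bound \<open>d\<close> keeps integrability and \<open>r > 2 M\<close>, the
    bound \<open>r\<^sub>J\<close> keeps the radius positive, and \<open>1 / t\<close> ensures
    convergence of the series for \<open>C_matrix\<close>. Since
    \<open>t \<ge> 1 / \<delta>\<close>, the series of the system matrix converges as well.\<close>
  define \<rho> where "\<rho> = min (min d r\<^sub>J) (1 / t)"
  have \<rho>: "\<rho> > 0" "\<rho> \<le> d" "\<rho> \<le> r\<^sub>J" "\<rho> \<le> 1 / t" "\<rho> \<le> \<delta>"
    using d(1) rJ t0 t \<delta>(1) by (auto simp: \<rho>_def min_le_iff_disj field_simps)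
  have sumC: "summable (\<lambda>m. norm (x^m *\<^sub>R C_coeff Am m))" if "\<bar>x\<bar> < \<rho>" for x
  proof (rule summable_norm_of_geometric_bound[OF t0 Cm])
    have "\<bar>x\<bar> < 1 / t" using that \<rho>(4) by linarith
    then show "\<bar>x\<bar> * t < 1" using t0 by (simp add: pos_less_divide_eq)
  qed
  have sumA: "summable (\<lambda>m. norm (x^m *\<^sub>R Am m))" if "\<bar>x\<bar> < \<rho>" for x
    using less_le_trans[OF that \<rho>(5)] \<delta>
    by (intro summable_norm_of_geometric_bound[of "1 / \<delta>" _ N]) (simp_all add: field_simps)
  let ?B = "ball r\<^sub>J \<rho>"
  have pos: "r > 0 \<and> r > 2 * mass \<mu> r" if "r \<in> ?B" for r
    using that d(2)[of r] \<rho> by (auto simp: dist_real_def)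
  have A_cont: "continuous_on ?B (sys_matrix \<mu>)"
    using continuous_on_subset[OF continuous_on_power_series_matrix[OF sums] subset_ball[OF \<rho>(5)]]
    by simp
  have mass': "(mass \<mu> has_real_derivative \<mu> r * r^2 / 2) (at r)" if r: "r \<in> ?B" for r
  proof -
    have ev: "\<forall>\<^sub>F x in nhds r. x \<in> ?B"
      using r by (intro eventually_nhds_in_open) auto
    then have int: "\<forall>\<^sub>F x in nhds r. (\<lambda>x. \<mu> x * x^2) integrable_on {0..x}"
      by eventually_elim (use d(2) \<rho>(2) in auto)
    have "\<forall>\<^sub>F x in nhds r. x > 2 * mass \<mu> x"
      using ev by eventually_elim (use pos in auto)
    then have "isCont \<mu> r"
    proof (rule isCont_mu[rotated 1])
      show "isCont (mass \<mu>) r" using pos[OF r] int by (blast intro: isCont_mass)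
      show "isCont (sys_matrix \<mu>) r"
        using A_cont r by (simp add: continuous_on_eq_continuous_at)
    qed (use pos[OF r] in simp)
    then show ?thesis
      using pos[OF r] int mass_has_derivative by blast
  qed
  have C_solves: "solves_system (sys_matrix \<mu>) (\<lambda>r. C_matrix Am r\<^sub>J r *v c) r" if r: "r \<in> ?B" for r c
  proof -
    have "(\<Sum>m. (r - r\<^sub>J)^m *\<^sub>R Am m) = sys_matrix \<mu> r"
      using sums[of r] r \<rho>(5) by (auto simp: sums_iff)
    then show ?thesis
      using C_matrix_solves_system[OF sumA sumC r, of c] by (simp add: solves_system_def)
  qed
  have C_sums: "(\<lambda>m. (r - r\<^sub>J)^m *\<^sub>R (C_coeff Am m *v c)) sums (C_matrix Am r\<^sub>J r *v c)"
    if r: "r \<in> ?B" for r c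
  proof -
    have "(\<lambda>m. (r - r\<^sub>J)^m *\<^sub>R C_coeff Am m) sums C_matrix Am r\<^sub>J r"
      unfolding C_matrix_def
      by (intro summable_sums summable_norm_cancel[OF sumC]) (use r in \<open>auto simp: dist_real_def\<close>)
    from bounded_linear.sums[OF bounded_bilinear.bounded_linear_left[OF
        bounded_bilinear_matrix_vector_mult] this]
    show ?thesis by (simp add: scaleR_matrix_vector_assoc)
  qed
  show ?thesis
  proof (intro exI[of _ \<rho>] conjI ballI allI impI \<rho>(1))
    show "summable (\<lambda>m. (r - r\<^sub>J)^m *\<^sub>R C_coeff Am m)" if "r \<in> ?B" for r
      by (rule summable_norm_cancel[OF sumC]) (use that in \<open>auto simp: dist_real_def\<close>)
  next
    fix \<eta> p s u
    assume \<eta>: "0 < \<eta> \<and> \<eta> \<le> \<rho>" and nv: "\<forall>r\<in>ball r\<^sub>J \<eta>. new_variables \<mu> p s u r"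
    have "TOV \<mu> p r \<longleftrightarrow> solves_system (sys_matrix \<mu>) (\<lambda>r. vector [s r, u r]) r"
      if r: "r \<in> ball r\<^sub>J \<eta>" for r
      using \<eta> r nv by (intro TOV_iff_solves_system[OF open_ball r] pos mass') auto
    then show "(\<forall>r\<in>ball r\<^sub>J \<eta>. TOV \<mu> p r) \<longleftrightarrow>
        (\<forall>r\<in>ball r\<^sub>J \<eta>. solves_system (sys_matrix \<mu>) (\<lambda>r. vector [s r, u r]) r)"
      by blast
  next
    fix \<eta> and W :: "real \<Rightarrow> real^2"
    assume \<eta>: "0 < \<eta> \<and> \<eta> \<le> \<rho>"
    then have sub: "ball r\<^sub>J \<eta> \<subseteq> ?B" by auto
    show "(real_analytic_at W r\<^sub>J \<and> (\<forall>r\<in>ball r\<^sub>J \<eta>. solves_system (sys_matrix \<mu>) W r)) \<longleftrightarrow>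
        (\<exists>c\<^sub>1 c\<^sub>2. \<forall>r\<in>ball r\<^sub>J \<eta>. W r = C_matrix Am r\<^sub>J r *v vector [c\<^sub>1, c\<^sub>2])"
    proof (intro iffI conjI ballI)
      assume W: "real_analytic_at W r\<^sub>J \<and> (\<forall>r\<in>ball r\<^sub>J \<eta>. solves_system (sys_matrix \<mu>) W r)"
      \<comment> \<open>The constants are the components of \<open>W r\<^sub>J\<close>, because
        \<open>C_matrix\<close> is the identity at the centre.\<close>
      have "W r = C_matrix Am r\<^sub>J r *v vector [W r\<^sub>J $ 1, W r\<^sub>J $ 2]" if r: "r \<in> ball r\<^sub>J \<eta>" for r
      proof (rule solves_system_unique[where S = "ball r\<^sub>J \<eta>" and a = r\<^sub>J and t = r
            and A = "sys_matrix \<mu>" and V = W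
            and W = "\<lambda>r. C_matrix Am r\<^sub>J r *v vector [W r\<^sub>J $ 1, W r\<^sub>J $ 2]"])
        show "W r\<^sub>J = C_matrix Am r\<^sub>J r\<^sub>J *v vector [W r\<^sub>J $ 1, W r\<^sub>J $ 2]"
          by (simp add: C_matrix_center vec_eq_iff forall_2)
      qed (use \<eta> r W sub C_solves continuous_on_subset[OF A_cont sub]
          in \<open>auto simp: is_interval_convex_1\<close>)
      then show "\<exists>c\<^sub>1 c\<^sub>2. \<forall>r\<in>ball r\<^sub>J \<eta>. W r = C_matrix Am r\<^sub>J r *v vector [c\<^sub>1, c\<^sub>2]"
        by blast
    next
      assume "\<exists>c\<^sub>1 c\<^sub>2. \<forall>r\<in>ball r\<^sub>J \<eta>. W r = C_matrix Am r\<^sub>J r *v vector [c\<^sub>1, c\<^sub>2]"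
      then obtain c where W: "\<And>r. r \<in> ball r\<^sub>J \<eta> \<Longrightarrow> W r = C_matrix Am r\<^sub>J r *v c"
        by blast
      have "(\<lambda>m. (r - r\<^sub>J)^m *\<^sub>R (C_coeff Am m *v c)) sums W r" if "r \<in> ball r\<^sub>J \<eta>" for r
        using C_sums[of r c] that sub W by auto
      then show "real_analytic_at W r\<^sub>J"
        unfolding real_analytic_at_def has_power_series_at_def using \<eta>
        by (intro exI[of _ "\<lambda>m. C_coeff Am m *v c"] exI[of _ \<eta>]) simp
      fix r assume r: "r \<in> ball r\<^sub>J \<eta>"
      have "((\<lambda>r. C_matrix Am r\<^sub>J r *v c) has_vector_derivative sys_matrix \<mu> r *v W r) (at r)"
        using C_solves[of r c] r sub W by (auto simp: solves_system_def)
      then show "solves_system (sys_matrix \<mu>) W r"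
        unfolding solves_system_def
        by (rule has_vector_derivative_transform_within_open[OF _ open_ball r]) (simp add: W)
    qed
  next
    fix \<eta> p c\<^sub>1
    assume \<eta>: "0 < \<eta> \<and> \<eta> \<le> \<rho>" and TOV: "\<forall>r\<in>ball r\<^sub>J \<eta>. TOV \<mu> p r"
    then have sub: "ball r\<^sub>J \<eta> \<subseteq> ?B" by auto
    let ?W = "\<lambda>r. C_matrix Am r\<^sub>J r *v vector [c\<^sub>1, 1]"
    have W: "?W r\<^sub>J $ 1 = c\<^sub>1" "?W r\<^sub>J $ 2 = 1"
      by (simp_all add: C_matrix_center)
    \<comment> \<open>Here \<open>u\<close> equals 1 and \<open>s\<close> equals
      \<open>c\<^sub>1\<close> at \<open>r\<^sub>J\<close>, so \<open>s = Q u\<close> there reads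
      \<open>c\<^sub>1 = Q\<close>. The converse propagates this one equation over the ball.\<close>
    have "(\<forall>r\<in>ball r\<^sub>J \<eta>. new_variables \<mu> p (\<lambda>r. ?W r $ 1) (\<lambda>r. ?W r $ 2) r) \<longleftrightarrow>
        c\<^sub>1 = log_slope \<mu> p r\<^sub>J"
    proof (intro iffI ballI)
      assume "\<forall>r\<in>ball r\<^sub>J \<eta>. new_variables \<mu> p (\<lambda>r. ?W r $ 1) (\<lambda>r. ?W r $ 2) r"
      then have "new_variables \<mu> p (\<lambda>r. ?W r $ 1) (\<lambda>r. ?W r $ 2) r\<^sub>J"
        using \<eta> by simp
      then show "c\<^sub>1 = log_slope \<mu> p r\<^sub>J"
        using pos[of r\<^sub>J] \<rho>(1) W by (simp add: new_variables_iff)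
    next
      fix r assume c: "c\<^sub>1 = log_slope \<mu> p r\<^sub>J" and r: "r \<in> ball r\<^sub>J \<eta>"
      have "(\<lambda>r. vector [?W r $ 1, ?W r $ 2]) = ?W"
        by (simp add: fun_eq_iff vec_eq_iff forall_2)
      then show "new_variables \<mu> p (\<lambda>r. ?W r $ 1) (\<lambda>r. ?W r $ 2) r"
        using \<eta> sub W c TOV pos mass' C_solves continuous_on_subset[OF A_cont sub]
        by (intro new_variables_of_solution[OF _ _ r, of r\<^sub>J]) (auto simp: is_interval_convex_1)
    qed
    then show "(\<forall>r\<in>ball r\<^sub>J \<eta>. new_variables \<mu> p (\<lambda>r. ?W r $ 1) (\<lambda>r. ?W r $ 2) r) \<longleftrightarrow>
        c\<^sub>1 = r\<^sub>J / (2 * (1 - 2 * mass \<mu> r\<^sub>J / r\<^sub>J)) * (p r\<^sub>J + 2 * mass \<mu> r\<^sub>J / r\<^sub>J^3)"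
      by (simp add: log_slope_def)
  qed
qed

end
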